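(* For all non-negative integers $n,r$, the following identity holds in $\mathbb{R}[x]$: $$(x+2r)^n=\sum_{k=0}^n S^B_{n+r,k+r,r}\cdot(x-1)(x-3)\cdots(x-2k+1),$$ where the product for $k=0$ is $1$.
   Context: A set partition of $[\pm n]=\{\pm1,\dots,\pm n\}$ of type $B$ is a set partition of $[\pm n]$ such that (i) if $B$ is a block then $-B=\{-b: b\in B\}$ is also a block, and (ii) there is at most one block with $B=-B$ (called the zero block). The non-zero blocks come in pairs $\{B,-B\}$, and each pair is counted as one (representative) non-zero block. $S^B_{n,k,r}$ (the $r$-Stirling number of the second kind of type $B$) is the number of set partitions of $[\pm n]$ of type $B$ with exactly $k$ (representative) non-zero blocks in which none of $1,\dots,r$ lies in the zero block and $1,\dots,r$ lie in pairwise distinct pairs $\{B,-B\}$; in particular $S^B_{r,k,r}=\delta_{kr}$. *)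

theory Defs
  imports "HOL-Library.Disjoint_Sets" "HOL-Computational_Algebra.Polynomial"
begin

definition pm_set :: "nat \<Rightarrow> int set" where
  "pm_set n = {i. i \<noteq> 0 \<and> \<bar>i\<bar> \<le> int n}"

abbreviation neg_block :: "int set \<Rightarrow> int set" where
  "neg_block B \<equiv> uminus ` B"

definition typeB_partition :: "nat \<Rightarrow> int set set \<Rightarrow> bool" where
  "typeB_partition n P \<longleftrightarrow>
     partition_on (pm_set n) P \<and>
     (\<forall>B\<in>P. neg_block B \<in> P) \<and>
     (\<forall>B\<in>P. \<forall>C\<in>P. B = neg_block B \<longrightarrow> C = neg_block C \<longrightarrow> B = C)"

text \<open>The representative non-zero blocks, as pairs consisting of a non-zero block and its negative.\<close>

definition nonzero_pairs :: "int set set \<Rightarrow> int set set set" where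
  "nonzero_pairs P = {{B, neg_block B} |B. B \<in> P \<and> B \<noteq> neg_block B}"

definition r_separated :: "nat \<Rightarrow> int set set \<Rightarrow> bool" where
  "r_separated r P \<longleftrightarrow>
     (\<forall>i\<in>{1..r}. \<exists>B\<in>P. int i \<in> B \<and> B \<noteq> neg_block B) \<and>
     (\<forall>i\<in>{1..r}. \<forall>j\<in>{1..r}. \<forall>B\<in>P. \<forall>C\<in>P.
        i \<noteq> j \<longrightarrow> int i \<in> B \<longrightarrow> int j \<in> C \<longrightarrow> {B, neg_block B} \<noteq> {C, neg_block C})"

text \<open>
  The intended range is \<open>r \<le> n\<close>; for \<open>r > n\<close> the number is 0, as \<open>r\<close> then lies in no block.
\<close>

definition r_Stirling_B :: "nat \<Rightarrow> nat \<Rightarrow> nat \<Rightarrow> nat" where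
  "r_Stirling_B n k r =
     card {P. typeB_partition n P \<and> card (nonzero_pairs P) = k \<and> r_separated r P}"

end

theory Submission
  imports Defs
begin

text \<open>
  Write $p_j = (x-1)(x-3) \cdots (x-2j+1)$ and give each $r$-separated partition of type B of
  $[\pm N]$ that has $k$ pairs of non-zero blocks the weight $p_{k-r}$. Grouping the partitions of
  $[\pm (n+r)]$ by $k$ shows that the right-hand side of the theorem is their total weight, so it
  is enough to see that the total weight is $1$ for $N = r$ and is multiplied by $x + 2r$ whenever
  $N \ge r$ grows by one.

  For $N = r$ no two elements can share a block, so the partition into singletons is the only one
  (\<open>separated_partitions_base\<close>). For the step, every partition of $[\pm (N+1)]$ arises exactly once
  from a partition $Q$ of $[\pm N]$ by choosing the block of $N+1$; the block of $-(N+1)$ is then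
  forced. If $Q$ has $k$ pairs, then $N+1$ may join one of the $2k$ non-zero blocks, or join the zero
  block (together with $-(N+1)$, creating that block if there was none), or form a
  singleton. The first $2k+1$ choices keep the number of pairs, the last one raises it by one
  (\<open>card_new_blocks\<close>, \<open>card_nonzero_pairs_extend\<close>). None of this disturbs $r$-separation, which depends
  only on the elements of absolute value at most $r$. Hence $Q$ contributes
  \[ (2k+1) p_{k-r} + p_{k+1-r} = \bigl(2k+1 + x - 2(k-r) - 1\bigr) p_{k-r} = (x+2r) p_{k-r}, \]
  which is the induction step in \<open>sum_odd_products\<close>. Summing weights over partitions avoids a separate
  recurrence for the numbers themselves and makes the grouping by $k$ a single final step.
\<close>

section \<open>Type B partitions and their blocks\<close>

definition separated_partitions :: "nat \<Rightarrow> nat \<Rightarrow> int set set set" where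
  "separated_partitions r n = {P. typeB_partition n P \<and> r_separated r P}"

definition nonzero_blocks :: "int set set \<Rightarrow> int set set" where
  "nonzero_blocks P = {B \<in> P. B \<noteq> neg_block B}"

lemma nonzero_pairs_eq: "nonzero_pairs P = (\<lambda>B. {B, neg_block B}) ` nonzero_blocks P"
  by (simp add: nonzero_pairs_def nonzero_blocks_def image_Collect)

lemma mem_neg_block: "x \<in> neg_block B \<longleftrightarrow> - x \<in> (B :: int set)"
  by (metis add.inverse_inverse image_iff)

lemma neg_block_neg_block [simp]: "neg_block (neg_block B) = B"
  by (simp add: image_image)

lemma neg_block_eq_swap: "neg_block B = C \<longleftrightarrow> B = neg_block C"
  by auto

lemma mem_pm_set_Suc:
  "x \<in> pm_set (Suc n) \<longleftrightarrow> x \<in> pm_set n \<or> x = int (Suc n) \<or> x = - int (Suc n)"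
  by (auto simp: pm_set_def)

lemma Suc_notin_pm_set [simp]: "int (Suc n) \<notin> pm_set n" "- int (Suc n) \<notin> pm_set n"
  by (auto simp: pm_set_def)

lemma Suc_in_pm_set_Suc [simp]: "int (Suc n) \<in> pm_set (Suc n)" "- int (Suc n) \<in> pm_set (Suc n)"
  by (auto simp: pm_set_def)

lemma uminus_pm_set [simp]: "- x \<in> pm_set n \<longleftrightarrow> x \<in> pm_set n"
  by (auto simp: pm_set_def)

text \<open>
  The new element \<open>int (Suc n)\<close> has to stay in this form: rewritten to \<open>1 + int n\<close> it would
  no longer match the membership rules above.
\<close>

declare of_nat_Suc [simp del]

lemma pm_set_mono: "m \<le> n \<Longrightarrow> pm_set m \<subseteq> pm_set n"
  by (auto simp: pm_set_def)

lemma finite_pm_set [simp]: "finite (pm_set n)"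
proof (rule finite_subset)
  show "pm_set n \<subseteq> {- int n..int n}" by (auto simp: pm_set_def)
qed simp

context
  fixes n :: nat and P :: "int set set"
  assumes P: "typeB_partition n P"
begin

lemma typeB_partition_on: "partition_on (pm_set n) P"
  using P by (simp add: typeB_partition_def)

lemma typeB_subset: "B \<in> P \<Longrightarrow> B \<subseteq> pm_set n"
  using partition_onD1[OF typeB_partition_on] by blast

lemma typeB_nonempty: "B \<in> P \<Longrightarrow> B \<noteq> {}"
  using partition_onD3[OF typeB_partition_on] by blast

lemma typeB_empty_notin: "{} \<notin> P"
  using typeB_nonempty by blast

lemma typeB_same_block: "B \<in> P \<Longrightarrow> C \<in> P \<Longrightarrow> x \<in> B \<Longrightarrow> x \<in> C \<Longrightarrow> B = C"
  using disjointD[OF partition_onD2[OF typeB_partition_on]] by blast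

lemma typeB_cover: "x \<in> pm_set n \<Longrightarrow> \<exists>B\<in>P. x \<in> B"
  using partition_onD1[OF typeB_partition_on] by blast

lemma typeB_neg_block: "B \<in> P \<Longrightarrow> neg_block B \<in> P"
  using P unfolding typeB_partition_def by blast

lemma typeB_zero_unique: "B \<in> P \<Longrightarrow> C \<in> P \<Longrightarrow> B = neg_block B \<Longrightarrow> C = neg_block C \<Longrightarrow> B = C"
  using P unfolding typeB_partition_def by blast

text \<open>
  The blocks \<open>B\<close> and \<open>neg_block B\<close> share \<open>x\<close>. So a block is either symmetric or disjoint from its
  negative, and a single pair of opposite elements identifies the zero block.
\<close>

lemma typeB_zero_if_opposite: "B \<in> P \<Longrightarrow> x \<in> B \<Longrightarrow> - x \<in> B \<Longrightarrow> B = neg_block B"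
  using typeB_same_block typeB_neg_block by (metis mem_neg_block)

lemma typeB_finite: "finite P"
  using typeB_subset finite_subset[of P "Pow (pm_set n)"] by auto

text \<open>
  Individual blocks are easier to follow through an insertion than unordered pairs of them; this
  converts between the two counts.
\<close>

lemma card_nonzero_blocks: "card (nonzero_blocks P) = 2 * card (nonzero_pairs P)"
proof -
  have U: "\<Union> (nonzero_pairs P) = nonzero_blocks P"
  proof (intro equalityI subsetI)
    fix B assume "B \<in> \<Union> (nonzero_pairs P)"
    then obtain C where "C \<in> P" "C \<noteq> neg_block C" "B = C \<or> B = neg_block C"
      unfolding nonzero_pairs_def by blast
    then show "B \<in> nonzero_blocks P"
      unfolding nonzero_blocks_def using typeB_neg_block by force
  next
    fix B assume "B \<in> nonzero_blocks P"
    then show "B \<in> \<Union> (nonzero_pairs P)"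
      unfolding nonzero_blocks_def nonzero_pairs_def by blast
  qed
  have "2 * card (nonzero_pairs P) = card (\<Union> (nonzero_pairs P))"
  proof (rule card_partition)
    have "nonzero_pairs P \<subseteq> Pow P"
      using typeB_neg_block by (auto simp: nonzero_pairs_def)
    then show "finite (nonzero_pairs P)"
      using typeB_finite finite_subset by blast
    show "finite (\<Union> (nonzero_pairs P))"
      unfolding U using typeB_finite by (simp add: nonzero_blocks_def)
    show "card c = 2" if "c \<in> nonzero_pairs P" for c
      using that unfolding nonzero_pairs_def by (elim CollectE exE conjE) simp
    show "c \<inter> d = {}" if "c \<in> nonzero_pairs P" "d \<in> nonzero_pairs P" "c \<noteq> d" for c d
    proof -
      have pair: "c = {E, neg_block E}" if c: "c \<in> nonzero_pairs P" "E \<in> c" for c E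
      proof -
        obtain C where C: "c = {C, neg_block C}"
          using c(1) unfolding nonzero_pairs_eq by blast
        then have "E = C \<or> E = neg_block C" using c(2) by simp
        then show ?thesis
        proof
          assume "E = neg_block C"
          then show ?thesis by (simp add: C insert_commute)
        qed (simp add: C)
      qed
      show ?thesis
      proof (rule ccontr)
        assume "c \<inter> d \<noteq> {}"
        then obtain E where E: "E \<in> c" "E \<in> d" by auto
        show False using that(3) pair[OF that(1) E(1)] pair[OF that(2) E(2)] by simp
      qed
    qed
  qed
  then show ?thesis by (simp add: U)
qed

text \<open>
  Both conditions in the definition say that certain elements of \<open>pm_set r\<close> are in different
  blocks: \<open>i\<close> is in a non-zero block iff \<open>i\<close> and \<open>- i\<close> are separated, and \<open>i\<close> and \<open>j\<close> are in
  different pairs iff \<open>i\<close> is separated from both \<open>j\<close> and \<open>- j\<close>. In this form the condition only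
  sees the traces of the blocks on \<open>pm_set r\<close>, which makes it stable under restriction.
\<close>

lemma r_separated_iff:
  assumes "r \<le> n"
  shows "r_separated r P \<longleftrightarrow> (\<forall>B\<in>P. \<forall>x\<in>B \<inter> pm_set r. \<forall>y\<in>B \<inter> pm_set r. x = y)"
proof
  assume sep: "r_separated r P"
  have nz: "B \<noteq> neg_block B" if "B \<in> P" "int i \<in> B" "i \<in> {1..r}" for B i
    using sep that typeB_same_block unfolding r_separated_def by metis
  have main: "i = j" if "B \<in> P" "int i \<in> B" "i \<in> {1..r}" "C \<in> P" "int j \<in> C" "j \<in> {1..r}"
    "C = B \<or> C = neg_block B" for B C i j
  proof (rule ccontr)
    assume "i \<noteq> j"
    then have ne: "{B, neg_block B} \<noteq> {C, neg_block C}"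
      using sep[unfolded r_separated_def, THEN conjunct2, rule_format] that by metis
    show False
      using that(7)
    proof
      assume "C = B"
      then show False using ne by simp
    next
      assume "C = neg_block B"
      then show False using ne by (simp add: insert_commute)
    qed
  qed
  show "\<forall>B\<in>P. \<forall>x\<in>B \<inter> pm_set r. \<forall>y\<in>B \<inter> pm_set r. x = y"
  proof (intro ballI)
    fix B x y
    assume B: "B \<in> P" and x: "x \<in> B \<inter> pm_set r" and y: "y \<in> B \<inter> pm_set r"
    define i j where "i = nat \<bar>x\<bar>" and "j = nat \<bar>y\<bar>"
    have ij: "i \<in> {1..r}" "j \<in> {1..r}" "x = int i \<or> x = - int i" "y = int j \<or> y = - int j"
      using x y by (auto simp: i_def j_def pm_set_def)
    have nB: "neg_block B \<in> P" by (rule typeB_neg_block[OF B])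
    have ib: "int i \<in> B \<or> int i \<in> neg_block B" "int j \<in> B \<or> int j \<in> neg_block B"
      using ij x y by (auto simp: mem_neg_block)
    then have "i = j"
      using main[OF B _ ij(1) B _ ij(2)] main[OF B _ ij(1) nB _ ij(2)]
        main[OF nB _ ij(1) B _ ij(2)] main[OF nB _ ij(1) nB _ ij(2)] by auto
    moreover have "\<not> (int i \<in> B \<and> - int i \<in> B)"
      using nz[OF B _ ij(1)] typeB_zero_if_opposite[OF B] by blast
    ultimately show "x = y"
      using ij x y by auto
  qed
next
  assume *: "\<forall>B\<in>P. \<forall>x\<in>B \<inter> pm_set r. \<forall>y\<in>B \<inter> pm_set r. x = y"
  have pm: "int i \<in> pm_set r" "- int i \<in> pm_set r" if "i \<in> {1..r}" for i
    using that by (auto simp: pm_set_def)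
  show "r_separated r P"
    unfolding r_separated_def
  proof (intro conjI ballI impI)
    fix i assume i: "i \<in> {1..r}"
    then obtain B where B: "B \<in> P" "int i \<in> B"
      using typeB_cover pm_set_mono[OF assms] pm by blast
    have "- int i \<notin> B"
    proof
      assume "- int i \<in> B"
      then have "int i = - int i" using * B pm[OF i] by blast
      then show False using i by simp
    qed
    then have "B \<noteq> neg_block B"
      using B(2) mem_neg_block[of "- int i" B] by auto
    then show "\<exists>B\<in>P. int i \<in> B \<and> B \<noteq> neg_block B" using B by blast
  next
    fix i j B C
    assume ij: "i \<in> {1..r}" "j \<in> {1..r}" "i \<noteq> j" and B: "B \<in> P" "int i \<in> B"
      and C: "C \<in> P" "int j \<in> C"
    show "{B, neg_block B} \<noteq> {C, neg_block C}"
    proof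
      assume "{B, neg_block B} = {C, neg_block C}"
      then have "B = C \<or> B = neg_block C" by (auto simp: doubleton_eq_iff)
      then have "int j \<in> B \<or> - int j \<in> B" using C by (auto simp: mem_neg_block)
      then have "int i = int j \<or> int i = - int j" using * B pm[OF ij(1)] pm[OF ij(2)] by blast
      then show False using ij by auto
    qed
  qed
qed

end

section \<open>Inserting a new pair of opposite elements\<close>

definition restrict_partition :: "nat \<Rightarrow> int set set \<Rightarrow> int set set" where
  "restrict_partition n P = (\<inter>) (pm_set n) ` P - {{}}"

text \<open>
  The possible blocks of \<open>int (Suc n)\<close> in an extension of \<open>Q\<close>, described by what is needed for the
  extension to be of type B: without its new elements the block is an old block or empty, it is
  symmetric or disjoint from its negative, and if it is symmetric, it absorbs the zero block of \<open>Q\<close>.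
  An explicit list of these blocks is \<open>new_blocks_eq\<close>.
\<close>

definition new_blocks :: "nat \<Rightarrow> int set set \<Rightarrow> int set set" where
  "new_blocks n Q = {B. int (Suc n) \<in> B \<and> B \<subseteq> pm_set (Suc n) \<and>
     pm_set n \<inter> B \<in> insert {} Q \<and> (B = neg_block B \<or> B \<inter> neg_block B = {}) \<and>
     (B = neg_block B \<longrightarrow> (\<forall>C\<in>Q. C = neg_block C \<longrightarrow> C = pm_set n \<inter> B))}"

definition extend_partition :: "nat \<Rightarrow> int set set \<Rightarrow> int set \<Rightarrow> int set set" where
  "extend_partition n Q B =
     (Q - {pm_set n \<inter> B, neg_block (pm_set n \<inter> B)}) \<union> {B, neg_block B}"

lemma pm_set_Int_neg_block: "pm_set n \<inter> neg_block B = neg_block (pm_set n \<inter> B)"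
  by (auto simp: mem_neg_block)

text \<open>
  Only the uniqueness of the zero block needs an argument: a non-empty symmetric trace contains
  opposite elements, so it comes from a symmetric block.
\<close>

lemma restrict_typeB:
  assumes P: "typeB_partition (Suc n) P"
  shows "typeB_partition n (restrict_partition n P)"
  unfolding typeB_partition_def
proof (intro conjI ballI impI)
  have "pm_set n \<inter> pm_set (Suc n) = pm_set n"
    by (auto simp: mem_pm_set_Suc)
  then show "partition_on (pm_set n) (restrict_partition n P)"
    using P partition_on_restrict[of "pm_set (Suc n)" P "pm_set n"]
    by (simp add: typeB_partition_def restrict_partition_def)
next
  fix B assume "B \<in> restrict_partition n P"
  then show "neg_block B \<in> restrict_partition n P"
    using typeB_neg_block[OF P]
    by (auto simp: restrict_partition_def simp flip: pm_set_Int_neg_block)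
next
  fix B C
  assume B: "B \<in> restrict_partition n P" "B = neg_block B"
    and C: "C \<in> restrict_partition n P" "C = neg_block C"
  have zero: "\<exists>B'\<in>P. B = pm_set n \<inter> B' \<and> B' = neg_block B'"
    if B: "B \<in> restrict_partition n P" "B = neg_block B" for B
  proof -
    obtain B' x where B': "B' \<in> P" "B = pm_set n \<inter> B'" and x: "x \<in> B"
      using B(1) by (auto simp: restrict_partition_def)
    have "- x \<in> B" using x B(2) mem_neg_block by blast
    then have "B' = neg_block B'"
      using typeB_zero_if_opposite[OF P B'(1)] x B' by blast
    then show ?thesis using B' by blast
  qed
  show "B = C"
    using zero[OF B] zero[OF C] typeB_zero_unique[OF P] by metis
qed

lemma restrict_separated:
  assumes P: "typeB_partition (Suc n) P" and r: "r \<le> n"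
  shows "r_separated r (restrict_partition n P) \<longleftrightarrow> r_separated r P"
proof -
  have mem: "pm_set n \<inter> B \<in> restrict_partition n P" if "B \<in> P" "x \<in> B \<inter> pm_set r" for B x
    using that pm_set_mono[OF r] by (auto simp: restrict_partition_def)
  show ?thesis
    unfolding r_separated_iff[OF P le_SucI[OF r]] r_separated_iff[OF restrict_typeB[OF P] r]
  proof (intro iffI ballI)
    fix B x y
    assume *: "\<forall>B\<in>restrict_partition n P. \<forall>x\<in>B \<inter> pm_set r. \<forall>y\<in>B \<inter> pm_set r. x = y"
      and B: "B \<in> P" "x \<in> B \<inter> pm_set r" "y \<in> B \<inter> pm_set r"
    have "x \<in> (pm_set n \<inter> B) \<inter> pm_set r" "y \<in> (pm_set n \<inter> B) \<inter> pm_set r"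
      using B pm_set_mono[OF r] by auto
    then show "x = y" by (rule *[rule_format, OF mem[OF B(1,2)]])
  next
    fix B x y
    assume *: "\<forall>B\<in>P. \<forall>x\<in>B \<inter> pm_set r. \<forall>y\<in>B \<inter> pm_set r. x = y"
      and B: "B \<in> restrict_partition n P" "x \<in> B \<inter> pm_set r" "y \<in> B \<inter> pm_set r"
    obtain C where C: "C \<in> P" "B = pm_set n \<inter> C"
      using B(1) by (auto simp: restrict_partition_def)
    show "x = y" by (rule *[rule_format, OF C(1)]) (use B C in auto)
  qed
qed

text \<open>
  Only \<open>B\<close> and its negative contain new elements, so all other blocks survive unchanged. The trace
  of \<open>B\<close> may be empty (then it disappears), and it may equal that of the negative (then \<open>B\<close> is the
  zero block); the formula covers these cases uniformly.
\<close>

lemma restrict_partition_eq: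
  assumes P: "typeB_partition (Suc n) P" and B: "B \<in> P" "int (Suc n) \<in> B"
  defines "X \<equiv> pm_set n \<inter> B"
  shows "restrict_partition n P = (P - {B, neg_block B}) \<union> ({X, neg_block X} - {{}})"
    and "X \<notin> P" "neg_block X \<notin> P"
proof -
  have other: "pm_set n \<inter> C = C" if "C \<in> P" "C \<noteq> B" "C \<noteq> neg_block B" for C
  proof -
    have "- int (Suc n) \<notin> C"
    proof
      assume "- int (Suc n) \<in> C"
      moreover have "- int (Suc n) \<in> neg_block B" using B(2) by (simp add: mem_neg_block)
      ultimately have "C = neg_block B"
        by (rule typeB_same_block[OF P that(1) typeB_neg_block[OF P B(1)]])
      then show False using that(3) by simp
    qed
    moreover have "int (Suc n) \<notin> C"
      using typeB_same_block[OF P that(1) B(1)] B that by blast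
    ultimately show "pm_set n \<inter> C = C"
      using typeB_subset[OF P that(1)] by (auto simp: mem_pm_set_Suc subset_iff)
  qed
  have nX: "pm_set n \<inter> neg_block B = neg_block X"
    by (simp add: X_def pm_set_Int_neg_block)
  have P': "P = (P - {B, neg_block B}) \<union> {B, neg_block B}"
    using B typeB_neg_block[OF P] by blast
  have "(\<inter>) (pm_set n) ` P = (\<lambda>C. C) ` (P - {B, neg_block B}) \<union> {X, neg_block X}"
    by (subst P') (use nX X_def other in \<open>auto simp: image_Un\<close>)
  then show "restrict_partition n P = (P - {B, neg_block B}) \<union> ({X, neg_block X} - {{}})"
    unfolding restrict_partition_def using typeB_empty_notin[OF P] by auto
  show "X \<notin> P"
  proof
    assume X: "X \<in> P"
    then obtain x where "x \<in> X" using typeB_nonempty[OF P] by blast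
    then have "X = B" using typeB_same_block[OF P X B(1)] by (auto simp: X_def)
    then show False using B X_def by (metis Int_iff Suc_notin_pm_set(1))
  qed
  then show "neg_block X \<notin> P"
    using typeB_neg_block[OF P, of "neg_block X"] by auto
qed

lemma extend_restrict:
  assumes P: "typeB_partition (Suc n) P" and B: "B \<in> P" "int (Suc n) \<in> B"
  shows "extend_partition n (restrict_partition n P) B = P"
proof -
  have "{B, neg_block B} \<subseteq> P" using B typeB_neg_block[OF P] by blast
  then show ?thesis
    using restrict_partition_eq[OF P B] unfolding extend_partition_def by auto
qed

lemma block_in_new_blocks:
  assumes P: "typeB_partition (Suc n) P" and B: "B \<in> P" "int (Suc n) \<in> B"
  shows "B \<in> new_blocks n (restrict_partition n P)"
  unfolding new_blocks_def
proof (intro CollectI conjI impI ballI)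
  show "int (Suc n) \<in> B" by (rule B(2))
  show "B \<subseteq> pm_set (Suc n)" by (rule typeB_subset[OF P B(1)])
  show "pm_set n \<inter> B \<in> insert {} (restrict_partition n P)"
    using B by (auto simp: restrict_partition_def)
  show "B = neg_block B \<or> B \<inter> neg_block B = {}"
    using typeB_same_block[OF P B(1) typeB_neg_block[OF P B(1)]] by blast
next
  fix C assume "B = neg_block B" and C: "C \<in> restrict_partition n P" "C = neg_block C"
  obtain C' x where C': "C' \<in> P" "C = pm_set n \<inter> C'" and x: "x \<in> C"
    using C(1) by (auto simp: restrict_partition_def)
  have "- x \<in> C" using x C(2) mem_neg_block by blast
  then have "C' = neg_block C'"
    using typeB_zero_if_opposite[OF P C'(1)] x C' by blast
  then have "C' = B"
    using typeB_zero_unique[OF P C'(1) B(1)] \<open>B = neg_block B\<close> by blast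
  then show "C = pm_set n \<inter> B" using C' by simp
qed

text \<open>
  The blocks of \<open>Q\<close> that are kept are disjoint from the trace of \<open>B\<close> and from its negative, hence
  also from \<open>B\<close> and its negative, which add only new elements. The last clause in the
  definition of \<open>new_blocks\<close> prevents the old zero block from surviving next to a new one.
\<close>

lemma extend_typeB:
  assumes Q: "typeB_partition n Q" and B: "B \<in> new_blocks n Q"
  shows "typeB_partition (Suc n) (extend_partition n Q B)"
proof -
  define X where "X = pm_set n \<inter> B"
  have aB: "int (Suc n) \<in> B" and BS: "B \<subseteq> pm_set (Suc n)" and X: "X = {} \<or> X \<in> Q"
    and B2: "B = neg_block B \<or> B \<inter> neg_block B = {}"
    and B0: "\<And>C. B = neg_block B \<Longrightarrow> C \<in> Q \<Longrightarrow> C = neg_block C \<Longrightarrow> C = X"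
    using B by (auto simp: new_blocks_def X_def)
  have E: "extend_partition n Q B = (Q - {X, neg_block X}) \<union> {B, neg_block B}"
    by (simp add: extend_partition_def X_def)
  have disj: "C \<inter> B = {}" "C \<inter> neg_block B = {}" if C: "C \<in> Q" "C \<noteq> X" "C \<noteq> neg_block X" for C
  proof -
    have CX: "C \<inter> X = {}" "C \<inter> neg_block X = {}"
      using typeB_same_block[OF Q C(1), of X] typeB_same_block[OF Q C(1), of "neg_block X"]
        typeB_neg_block[OF Q, of X] X C by auto
    have Cn: "C \<subseteq> pm_set n" by (rule typeB_subset[OF Q C(1)])
    show "C \<inter> B = {}" using CX(1) Cn by (auto simp: X_def)
    show "C \<inter> neg_block B = {}"
      using CX(2) Cn by (simp only: X_def flip: pm_set_Int_neg_block) blast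
  qed
  show ?thesis
    unfolding typeB_partition_def
  proof (intro conjI ballI impI)
    show "partition_on (pm_set (Suc n)) (extend_partition n Q B)"
      unfolding partition_on_def
    proof (intro conjI)
      show "\<Union> (extend_partition n Q B) = pm_set (Suc n)"
      proof (intro equalityI subsetI)
        fix x assume "x \<in> \<Union> (extend_partition n Q B)"
        then consider C where "C \<in> Q" "x \<in> C" | "x \<in> B" | "- x \<in> B"
          by (auto simp: E mem_neg_block)
        then show "x \<in> pm_set (Suc n)"
        proof cases
          case 1
          then show ?thesis using typeB_subset[OF Q] by (auto simp: mem_pm_set_Suc)
        next
          case 2
          then show ?thesis using BS by blast
        next
          case 3
          then show ?thesis using BS uminus_pm_set by blast
        qed
      next
        fix x assume "x \<in> pm_set (Suc n)"
        then consider "x \<in> pm_set n" | "x = int (Suc n)" | "x = - int (Suc n)"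
          by (auto simp: mem_pm_set_Suc)
        then show "x \<in> \<Union> (extend_partition n Q B)"
        proof cases
          case 1
          then obtain C where C: "C \<in> Q" "x \<in> C" using typeB_cover[OF Q] by blast
          have "X \<subseteq> B" "neg_block X \<subseteq> neg_block B" by (auto simp: X_def)
          then show ?thesis using C by (cases "C = X \<or> C = neg_block X") (auto simp: E)
        next
          case 2
          then show ?thesis using aB by (auto simp: E)
        next
          case 3
          then have "x \<in> neg_block B" using aB by (auto simp: mem_neg_block)
          then show ?thesis by (auto simp: E)
        qed
      qed
      show "disjoint (extend_partition n Q B)"
        unfolding disjoint_def
      proof (intro ballI impI)
        fix C D
        assume C: "C \<in> extend_partition n Q B" and D: "D \<in> extend_partition n Q B" and "C \<noteq> D"
        have mem: "C \<in> Q - {X, neg_block X} \<or> C \<in> {B, neg_block B}"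
          if "C \<in> extend_partition n Q B" for C
          using that unfolding E by (rule UnE) simp_all
        from mem[OF C] mem[OF D] consider "C \<in> Q - {X, neg_block X}" "D \<in> Q - {X, neg_block X}"
          | "C \<in> Q - {X, neg_block X}" "D \<in> {B, neg_block B}"
          | "D \<in> Q - {X, neg_block X}" "C \<in> {B, neg_block B}"
          | "C \<in> {B, neg_block B}" "D \<in> {B, neg_block B}"
          by argo
        then show "C \<inter> D = {}"
        proof cases
          case 1
          then show ?thesis using typeB_same_block[OF Q] \<open>C \<noteq> D\<close> by blast
        next
          case 2
          then show ?thesis using disj[of C] by auto
        next
          case 3
          then show ?thesis using disj[of D] by auto
        next
          case 4
          then have CD: "C = B \<and> D = neg_block B \<or> C = neg_block B \<and> D = B"
            using \<open>C \<noteq> D\<close> by (elim insertE) simp_all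
          then have "B \<noteq> neg_block B" using \<open>C \<noteq> D\<close> by metis
          then have "B \<inter> neg_block B = {}" using B2 by simp
          then show ?thesis using CD by (elim disjE) (simp_all add: Int_commute)
        qed
      qed
      show "{} \<notin> extend_partition n Q B"
        using typeB_empty_notin[OF Q] aB by (auto simp: E)
    qed
  next
    fix C assume "C \<in> extend_partition n Q B"
    then show "neg_block C \<in> extend_partition n Q B"
      using typeB_neg_block[OF Q] by (auto simp: E neg_block_eq_swap)
  next
    fix C D
    assume C: "C \<in> extend_partition n Q B" "C = neg_block C"
      and D: "D \<in> extend_partition n Q B" "D = neg_block D"
    have *: "C = B \<and> B = neg_block B \<or> C \<in> Q - {X} \<and> C = neg_block C"
      if "C \<in> extend_partition n Q B" "C = neg_block C" for C
      using that by (auto simp: E)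
    show "C = D"
      using *[OF C] *[OF D]
    proof (elim disjE conjE)
      assume "C \<in> Q - {X}" "D \<in> Q - {X}"
      then show ?thesis using typeB_zero_unique[OF Q _ _ C(2) D(2)] by simp
    next
      assume "B = neg_block B" "D \<in> Q - {X}"
      then show ?thesis using B0[OF _ _ D(2)] by simp
    next
      assume "B = neg_block B" "C \<in> Q - {X}"
      then show ?thesis using B0[OF _ _ C(2)] by simp
    qed simp
  qed
qed

lemma new_block_notin:
  assumes Q: "typeB_partition n Q" and B: "B \<in> new_blocks n Q"
  shows "B \<notin> Q" "neg_block B \<notin> Q"
proof -
  show "B \<notin> Q"
  proof
    assume "B \<in> Q"
    then have "B \<subseteq> pm_set n" by (rule typeB_subset[OF Q])
    moreover have "int (Suc n) \<in> B" using B by (auto simp: new_blocks_def)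
    ultimately show False using Suc_notin_pm_set(1)[of n] by blast
  qed
  then show "neg_block B \<notin> Q"
    using typeB_neg_block[OF Q, of "neg_block B"] by auto
qed

lemma restrict_extend:
  assumes Q: "typeB_partition n Q" and B: "B \<in> new_blocks n Q"
  shows "restrict_partition n (extend_partition n Q B) = Q"
proof -
  define X where "X = pm_set n \<inter> B"
  have aB: "int (Suc n) \<in> B" and X: "X = {} \<or> X \<in> Q"
    using B by (auto simp: new_blocks_def X_def)
  have BE: "B \<in> extend_partition n Q B" by (simp add: extend_partition_def)
  note nQ = new_block_notin[OF Q B]
  have "restrict_partition n (extend_partition n Q B)
      = (extend_partition n Q B - {B, neg_block B}) \<union> ({X, neg_block X} - {{}})"
    unfolding X_def by (rule restrict_partition_eq(1)[OF extend_typeB[OF Q B] BE aB])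
  also have "\<dots> = (Q - {X, neg_block X}) \<union> ({X, neg_block X} - {{}})"
    using nQ by (auto simp: extend_partition_def X_def)
  also have "\<dots> = Q"
    using X typeB_empty_notin[OF Q] typeB_neg_block[OF Q] by auto
  finally show ?thesis .
qed

section \<open>Counting the extensions\<close>

text \<open>
  The zero block, or the empty set if there is none, so that both cases of joining
  the new elements to it have the same form.
\<close>

definition zero_elements :: "int set set \<Rightarrow> int set" where
  "zero_elements Q = \<Union> {C \<in> Q. C = neg_block C}"

lemma zero_elements_eq:
  assumes "typeB_partition n Q" "C \<in> Q" "C = neg_block C"
  shows "zero_elements Q = C"
  using typeB_zero_unique[OF assms(1)] assms(2,3) unfolding zero_elements_def by blast

lemma nonzero_block_disjoint:
  assumes "typeB_partition n Q" "X \<in> insert {} (nonzero_blocks Q)"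
  shows "X \<inter> neg_block X = {}"
  using assms(2) typeB_same_block[OF assms(1), of X "neg_block X"] typeB_neg_block[OF assms(1), of X]
  by (auto simp: nonzero_blocks_def)

text \<open>
  A symmetric new block contains both new elements and has the zero block (or nothing) as its
  trace. Any other new block is disjoint from its negative, so it contains one new element, and
  its trace is non-zero or empty; the empty trace gives the new singleton.
\<close>

lemma new_blocks_eq:
  assumes Q: "typeB_partition n Q"
  shows "new_blocks n Q =
     insert (insert (int (Suc n)) (insert (- int (Suc n)) (zero_elements Q)))
       (insert (int (Suc n)) ` insert {} (nonzero_blocks Q))" (is "_ = insert ?Z (?ins ` ?N)")
proof (intro equalityI subsetI)
  fix B assume "B \<in> new_blocks n Q"
  define X where "X = pm_set n \<inter> B"
  have aB: "int (Suc n) \<in> B" and BS: "B \<subseteq> pm_set (Suc n)" and X: "X = {} \<or> X \<in> Q"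
    and B2: "B = neg_block B \<or> B \<inter> neg_block B = {}"
    and B0: "\<And>C. B = neg_block B \<Longrightarrow> C \<in> Q \<Longrightarrow> C = neg_block C \<Longrightarrow> C = X"
    using \<open>B \<in> new_blocks n Q\<close> by (auto simp: new_blocks_def X_def)
  show "B \<in> insert ?Z (?ins ` ?N)"
  proof (cases "B = neg_block B")
    case True
    then have "neg_block X = X"
      using pm_set_Int_neg_block[of n B] by (simp add: X_def)
    moreover have "zero_elements Q = X"
    proof (cases "X = {}")
      case True
      then show ?thesis using B0[OF \<open>B = neg_block B\<close>] by (auto simp: zero_elements_def)
    next
      case False
      then show ?thesis using X zero_elements_eq[OF Q] \<open>neg_block X = X\<close> by auto
    qed
    moreover have "- int (Suc n) \<in> B"
      using aB True mem_neg_block[of "- int (Suc n)" B] by simp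
    ultimately have "B = ?Z"
      using aB BS by (auto simp: X_def mem_pm_set_Suc subset_iff)
    then show ?thesis by blast
  next
    case False
    then have BB: "B \<inter> neg_block B = {}" using B2 by blast
    then have "- int (Suc n) \<notin> B" using aB by (auto simp: mem_neg_block disjoint_iff)
    then have "B = ?ins X" using aB BS by (auto simp: X_def mem_pm_set_Suc subset_iff)
    moreover have "X \<in> ?N"
      using X BB by (fastforce simp: X_def nonzero_blocks_def)
    ultimately show ?thesis by blast
  qed
next
  fix B assume "B \<in> insert ?Z (?ins ` ?N)"
  then consider "B = ?Z" | X where "X \<in> ?N" "B = ?ins X" by blast
  then show "B \<in> new_blocks n Q"
  proof cases
    case 1
    have Z: "zero_elements Q = {} \<and> (\<forall>C\<in>Q. C \<noteq> neg_block C) \<or>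
        zero_elements Q \<in> Q \<and> (\<forall>C\<in>Q. C = neg_block C \<longrightarrow> C = zero_elements Q)"
      using zero_elements_eq[OF Q] by (auto simp: zero_elements_def)
    have neg: "neg_block (zero_elements Q) = zero_elements Q"
    proof -
      have "- x \<in> zero_elements Q" if "x \<in> zero_elements Q" for x
        using that mem_neg_block unfolding zero_elements_def by fast
      then show ?thesis by (auto simp: mem_neg_block dest: minus_equation_iff[THEN iffD1])
    qed
    have sub: "zero_elements Q \<subseteq> pm_set n"
      using typeB_subset[OF Q] by (auto simp: zero_elements_def)
    have old: "pm_set n \<inter> ?Z = zero_elements Q" using sub by auto
    have "neg_block ?Z = ?Z" using neg by auto
    then have Zsym: "?Z = neg_block ?Z" by (rule sym)
    show ?thesis
      unfolding 1 new_blocks_def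
    proof (intro CollectI conjI impI ballI)
      show "?Z \<subseteq> pm_set (Suc n)" using sub by (auto simp: mem_pm_set_Suc)
      show "pm_set n \<inter> ?Z \<in> insert {} Q" unfolding old using Z by fast
      show "?Z = neg_block ?Z \<or> ?Z \<inter> neg_block ?Z = {}" using Zsym by (rule disjI1)
      show "C = pm_set n \<inter> ?Z" if "C \<in> Q" "C = neg_block C" for C
        unfolding old using zero_elements_eq[OF Q that] by (rule sym)
    qed simp
  next
    case 2
    have sub: "X \<subseteq> pm_set n"
      using 2 typeB_subset[OF Q] by (auto simp: nonzero_blocks_def)
    have "pm_set n \<inter> B = X" using sub 2 by auto
    moreover have disj: "B \<inter> neg_block B = {}"
      using nonzero_block_disjoint[OF Q 2(1)] sub 2(2) Suc_notin_pm_set[of n]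
      by (auto simp: mem_neg_block disjoint_iff)
    moreover have "B \<noteq> neg_block B" using disj 2 by auto
    moreover have "B \<subseteq> pm_set (Suc n)" using sub 2 by (auto simp: mem_pm_set_Suc)
    ultimately show ?thesis
      using 2 by (auto simp: new_blocks_def nonzero_blocks_def)
  qed
qed

lemma card_new_blocks:
  assumes Q: "typeB_partition n Q"
  shows "card (new_blocks n Q) = 2 * card (nonzero_pairs Q) + 2"
proof -
  let ?a = "int (Suc n)" and ?N = "insert {} (nonzero_blocks Q)"
  have sub: "X \<subseteq> pm_set n" if "X \<in> ?N" for X
    using that typeB_subset[OF Q] by (auto simp: nonzero_blocks_def)
  have a: "?a \<notin> X" "- ?a \<notin> X" if "X \<in> ?N" for X
    using sub[OF that] Suc_notin_pm_set[of n] by blast+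
  have fin: "finite (nonzero_blocks Q)"
    using typeB_finite[OF Q] by (simp add: nonzero_blocks_def)
  have "inj_on (insert ?a) ?N"
    using a by (intro inj_onI) (metis insert_ident)
  then have "card (insert ?a ` ?N) = card ?N" by (rule card_image)
  also have "\<dots> = 2 * card (nonzero_pairs Q) + 1"
    using typeB_empty_notin[OF Q] fin
    by (subst card_insert_disjoint) (auto simp: nonzero_blocks_def card_nonzero_blocks[OF Q, symmetric])
  finally have c: "card (insert ?a ` ?N) = 2 * card (nonzero_pairs Q) + 1" .
  have "insert ?a (insert (- ?a) (zero_elements Q)) \<notin> insert ?a ` ?N"
  proof
    assume "insert ?a (insert (- ?a) (zero_elements Q)) \<in> insert ?a ` ?N"
    then obtain X where X: "X \<in> ?N" "insert ?a (insert (- ?a) (zero_elements Q)) = insert ?a X"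
      by blast
    then have "- ?a \<in> insert ?a X" by blast
    then show False using a[OF X(1)] by simp
  qed
  then show ?thesis
    using fin c by (simp only: new_blocks_eq[OF Q]) (simp add: card_insert_disjoint)
qed

text \<open>
  If the trace of \<open>B\<close> is non-empty, then \<open>B\<close> and its negative replace old blocks of the same kind.
  If \<open>B\<close> is symmetric with empty trace, only a zero block is added. The singleton is the
  only choice left, and it brings a new pair.
\<close>

lemma card_nonzero_pairs_extend:
  assumes Q: "typeB_partition n Q" and B: "B \<in> new_blocks n Q"
  shows "card (nonzero_pairs (extend_partition n Q B)) =
    (if B = {int (Suc n)} then Suc (card (nonzero_pairs Q)) else card (nonzero_pairs Q))"
proof -
  let ?a = "int (Suc n)"
  define X where "X = pm_set n \<inter> B"
  have aB: "?a \<in> B" and BS: "B \<subseteq> pm_set (Suc n)" and X: "X = {} \<or> X \<in> Q"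
    and B2: "B = neg_block B \<or> B \<inter> neg_block B = {}"
    using B by (auto simp: new_blocks_def X_def)
  let ?P = "extend_partition n Q B"
  have E: "?P = (Q - {X, neg_block X}) \<union> {B, neg_block B}"
    by (simp add: extend_partition_def X_def)
  have fin: "finite (nonzero_blocks Q)"
    using typeB_finite[OF Q] by (simp add: nonzero_blocks_def)
  note nQ = new_block_notin[OF Q B]
  have nX: "neg_block X = pm_set n \<inter> neg_block B"
    by (simp add: X_def pm_set_Int_neg_block)
  have "card (nonzero_blocks ?P) =
    (if B = {?a} then card (nonzero_blocks Q) + 2 else card (nonzero_blocks Q))"
  proof (cases "B = neg_block B")
    case True
    then have "X = neg_block X" using nX by (simp add: X_def)
    then have "nonzero_blocks ?P = nonzero_blocks Q"
      using True by (auto simp: nonzero_blocks_def E)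
    moreover have "B \<noteq> {?a}" using True by auto
    ultimately show ?thesis by simp
  next
    case False
    then have disj: "B \<inter> neg_block B = {}" using B2 by blast
    have "- ?a \<notin> B" using disj aB by (auto simp: mem_neg_block disjoint_iff)
    then have BX: "B = insert ?a X" using aB BS by (auto simp: X_def mem_pm_set_Suc subset_iff)
    have "?a \<notin> X" by (simp add: X_def)
    have nz: "nonzero_blocks ?P = (nonzero_blocks Q - {X, neg_block X}) \<union> {B, neg_block B}"
      using False by (auto simp: nonzero_blocks_def E)
    have "card (nonzero_blocks ?P) = card (nonzero_blocks Q - {X, neg_block X}) + card {B, neg_block B}"
      unfolding nz using nQ fin by (intro card_Un_disjoint) (auto simp: nonzero_blocks_def)
    also have "card {B, neg_block B} = 2" using False by simp
    finally have c: "card (nonzero_blocks ?P) = card (nonzero_blocks Q - {X, neg_block X}) + 2" .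
    show ?thesis
    proof (cases "X = {}")
      case True
      then have "{} \<notin> nonzero_blocks Q" by (simp add: nonzero_blocks_def)
      then show ?thesis using c True BX by simp
    next
      case X0: False
      then have XQ: "X \<in> Q" using X by blast
      have "X \<inter> neg_block X = {}" using disj by (auto simp: X_def mem_neg_block disjoint_iff)
      then have ne: "X \<noteq> neg_block X" using X0 by blast
      then have sub: "{X, neg_block X} \<subseteq> nonzero_blocks Q"
        using XQ typeB_neg_block[OF Q XQ] by (auto simp: nonzero_blocks_def)
      have "card {X, neg_block X} \<le> card (nonzero_blocks Q)"
        by (rule card_mono[OF fin sub])
      then have "card (nonzero_blocks ?P) = card (nonzero_blocks Q)"
        using c ne card_Diff_subset[OF _ sub] by simp
      moreover have "B \<noteq> {?a}" using BX X0 \<open>?a \<notin> X\<close> by auto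
      ultimately show ?thesis by simp
    qed
  qed
  then show ?thesis
    unfolding card_nonzero_blocks[OF Q] card_nonzero_blocks[OF extend_typeB[OF Q B]]
    by (auto split: if_splits)
qed

lemma sum_new_blocks:
  fixes w :: "nat \<Rightarrow> 'a :: semiring_1"
  assumes Q: "typeB_partition n Q"
  defines "k \<equiv> card (nonzero_pairs Q)"
  shows "(\<Sum>B\<in>new_blocks n Q. w (card (nonzero_pairs (extend_partition n Q B))))
    = of_nat (2 * k + 1) * w k + w (Suc k)"
proof -
  let ?s = "{int (Suc n)}"
  have s: "?s \<in> new_blocks n Q" by (simp add: new_blocks_eq[OF Q])
  have fin: "finite (new_blocks n Q)"
    by (rule card_ge_0_finite) (simp add: card_new_blocks[OF Q])
  have "(\<Sum>B\<in>new_blocks n Q. w (card (nonzero_pairs (extend_partition n Q B))))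
      = (\<Sum>B\<in>new_blocks n Q. if B = ?s then w (Suc k) else w k)"
    by (intro sum.cong) (simp_all add: card_nonzero_pairs_extend[OF Q] k_def)
  also have "\<dots> = w (Suc k) + (\<Sum>B\<in>new_blocks n Q - {?s}. w k)"
    by (subst sum.remove[OF fin s]) (auto intro!: arg_cong2[where f = "(+)"] sum.cong)
  also have "(\<Sum>B\<in>new_blocks n Q - {?s}. w k) = of_nat (2 * k + 1) * w k"
    using fin s by (simp add: card_Diff_subset card_new_blocks[OF Q] k_def)
  finally show ?thesis by (simp add: add.commute)
qed

section \<open>Weighted sums over separated partitions\<close>

lemma finite_separated_partitions: "finite (separated_partitions r n)"
proof (rule finite_subset)
  show "separated_partitions r n \<subseteq> Pow (Pow (pm_set n))"
    using typeB_subset by (fastforce simp: separated_partitions_def)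
qed simp

lemma block_of_extension:
  assumes P: "typeB_partition (Suc n) (extend_partition n Q B)" and B: "B \<in> new_blocks n Q"
  shows "(THE C. C \<in> extend_partition n Q B \<and> int (Suc n) \<in> C) = B"
proof (rule the_equality)
  show BE: "B \<in> extend_partition n Q B \<and> int (Suc n) \<in> B"
    using B by (simp add: extend_partition_def new_blocks_def)
  show "C = B" if "C \<in> extend_partition n Q B \<and> int (Suc n) \<in> C" for C
    using typeB_same_block[OF P] that BE by blast
qed

text \<open>
  A partition \<open>P\<close> corresponds to the pair of its restriction and the block of \<open>int (Suc n)\<close> in \<open>P\<close>;
  extending the former by the latter inverts this.
\<close>

lemma sum_separated_Suc:
  fixes w :: "nat \<Rightarrow> 'a :: semiring_1"
  assumes r: "r \<le> n"
  shows "(\<Sum>P\<in>separated_partitions r (Suc n). w (card (nonzero_pairs P))) =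
    (\<Sum>Q\<in>separated_partitions r n. of_nat (2 * card (nonzero_pairs Q) + 1) * w (card (nonzero_pairs Q))
       + w (Suc (card (nonzero_pairs Q))))"
proof -
  let ?block = "\<lambda>P. THE B. B \<in> P \<and> int (Suc n) \<in> B"
  let ?S = "Sigma (separated_partitions r n) (new_blocks n)"
  have block: "?block P \<in> P" "int (Suc n) \<in> ?block P" if P: "typeB_partition (Suc n) P" for P
  proof -
    obtain B where B: "B \<in> P" "int (Suc n) \<in> B"
      using typeB_cover[OF P Suc_in_pm_set_Suc(1)] by blast
    then have "?block P = B"
      using typeB_same_block[OF P] by (intro the_equality) blast+
    then show "?block P \<in> P" "int (Suc n) \<in> ?block P" using B by auto
  qed
  have "(\<Sum>P\<in>separated_partitions r (Suc n). w (card (nonzero_pairs P))) =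
    (\<Sum>(Q, B)\<in>?S. w (card (nonzero_pairs (extend_partition n Q B))))"
  proof (rule sum.reindex_bij_witness[where j = "\<lambda>P. (restrict_partition n P, ?block P)"
        and i = "\<lambda>(Q, B). extend_partition n Q B"])
    fix P assume "P \<in> separated_partitions r (Suc n)"
    then have P: "typeB_partition (Suc n) P" and sep: "r_separated r P"
      by (auto simp: separated_partitions_def)
    show ext: "(\<lambda>(Q, B). extend_partition n Q B) (restrict_partition n P, ?block P) = P"
      using extend_restrict[OF P block[OF P]] by simp
    show "(restrict_partition n P, ?block P) \<in> ?S"
      using restrict_typeB[OF P] restrict_separated[OF P r] sep block_in_new_blocks[OF P block[OF P]]
      by (simp add: separated_partitions_def)
    show "(\<lambda>(Q, B). w (card (nonzero_pairs (extend_partition n Q B)))) (restrict_partition n P, ?block P)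
        = w (card (nonzero_pairs P))"
      using ext by simp
  next
    fix QB assume "QB \<in> ?S"
    then obtain Q B where QB: "QB = (Q, B)" and Q: "typeB_partition n Q" "r_separated r Q"
      and B: "B \<in> new_blocks n Q"
      by (auto simp: separated_partitions_def)
    note ext = extend_typeB[OF Q(1) B] and res = restrict_extend[OF Q(1) B]
    show "(restrict_partition n ((\<lambda>(Q, B). extend_partition n Q B) QB),
        ?block ((\<lambda>(Q, B). extend_partition n Q B) QB)) = QB"
      using res block_of_extension[OF ext B] by (simp add: QB)
    show "(\<lambda>(Q, B). extend_partition n Q B) QB \<in> separated_partitions r (Suc n)"
      using ext res restrict_separated[OF ext r] Q by (simp add: QB separated_partitions_def)
  qed
  also have "\<dots> = (\<Sum>Q\<in>separated_partitions r n. \<Sum>B\<in>new_blocks n Q.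
      w (card (nonzero_pairs (extend_partition n Q B))))"
  proof (rule sum.Sigma[symmetric])
    show "finite (separated_partitions r n)" by (rule finite_separated_partitions)
    show "\<forall>Q\<in>separated_partitions r n. finite (new_blocks n Q)"
      by (auto simp: separated_partitions_def card_new_blocks intro!: card_ge_0_finite)
  qed
  also have "\<dots> = (\<Sum>Q\<in>separated_partitions r n. of_nat (2 * card (nonzero_pairs Q) + 1) * w (card (nonzero_pairs Q))
       + w (Suc (card (nonzero_pairs Q))))"
    by (intro sum.cong refl sum_new_blocks) (simp add: separated_partitions_def)
  finally show ?thesis .
qed

lemma card_pm_set: "card (pm_set n) = 2 * n"
proof (induction n)
  case 0
  then show ?case by (simp add: pm_set_def)
next
  case (Suc n)
  have "pm_set (Suc n) = insert (int (Suc n)) (insert (- int (Suc n)) (pm_set n))"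
    by (auto simp: mem_pm_set_Suc)
  moreover have "int (Suc n) \<noteq> - int (Suc n)" by simp
  ultimately show ?case using Suc by (simp only: card_insert_disjoint finite_insert finite_pm_set
        insert_iff Suc_notin_pm_set simp_thms) simp
qed

lemma separated_partitions_base:
  "separated_partitions r r = {(\<lambda>x. {x}) ` pm_set r}"
  "card (nonzero_pairs ((\<lambda>x. {x}) ` pm_set r)) = r"
proof -
  let ?S = "(\<lambda>x. {x}) ` pm_set r"
  have nz: "{x} \<noteq> neg_block {x}" if "x \<in> pm_set r" for x
    using that by (auto simp: pm_set_def)
  have S: "typeB_partition r ?S"
    unfolding typeB_partition_def
    using nz partition_on_singletons[of "pm_set r"] by auto
  have "nonzero_blocks ?S = ?S" using nz by (auto simp: nonzero_blocks_def)
  then have "card (nonzero_blocks ?S) = 2 * r"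
    by (simp add: card_image card_pm_set)
  then show "card (nonzero_pairs ?S) = r" using card_nonzero_blocks[OF S] by simp
  have "P = ?S" if P: "typeB_partition r P" and sep: "r_separated r P" for P
  proof -
    have single: "B = {x}" if "B \<in> P" "x \<in> B" for B x
    proof -
      have "B \<subseteq> pm_set r" by (rule typeB_subset[OF P that(1)])
      moreover have "\<forall>y\<in>B \<inter> pm_set r. \<forall>z\<in>B \<inter> pm_set r. y = z"
        using sep r_separated_iff[OF P order_refl] that(1) by blast
      ultimately show ?thesis using that(2) by blast
    qed
    show ?thesis
    proof (intro equalityI subsetI)
      fix B assume B: "B \<in> P"
      then obtain x where x: "x \<in> B" using typeB_nonempty[OF P] by blast
      then show "B \<in> ?S" using single[OF B x] typeB_subset[OF P B] by blast
    next
      fix B assume "B \<in> ?S"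
      then obtain x where x: "x \<in> pm_set r" "B = {x}" by blast
      then show "B \<in> P" using typeB_cover[OF P x(1)] single by blast
    qed
  qed
  moreover have "r_separated r ?S" using r_separated_iff[OF S order_refl] by blast
  ultimately have "P \<in> separated_partitions r r \<longleftrightarrow> P = ?S" for P
    using S unfolding separated_partitions_def by blast
  then show "separated_partitions r r = {?S}" by blast
qed

text \<open>
  The number of pairs is \<open>r\<close> for \<open>n = r\<close>, and each insertion raises it by at most one. The lower
  bound makes the subtraction of \<open>r\<close> in the weights exact, and the upper bound gives the range
  of summation in the theorem.
\<close>

lemma card_nonzero_pairs_bounds:
  assumes "r \<le> n" "P \<in> separated_partitions r n"
  shows "r \<le> card (nonzero_pairs P) \<and> card (nonzero_pairs P) \<le> n"
  using assms
proof (induction n arbitrary: P rule: dec_induct)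
  case base
  then show ?case using separated_partitions_base[of r] by simp
next
  case (step n)
  then have P: "typeB_partition (Suc n) P" "r_separated r P"
    by (auto simp: separated_partitions_def)
  let ?Q = "restrict_partition n P"
  obtain B where B: "B \<in> P" "int (Suc n) \<in> B"
    using typeB_cover[OF P(1) Suc_in_pm_set_Suc(1)] by blast
  have Q: "typeB_partition n ?Q" by (rule restrict_typeB[OF P(1)])
  have "?Q \<in> separated_partitions r n"
    using Q restrict_separated[OF P(1)] P(2) step.hyps by (simp add: separated_partitions_def)
  then have "r \<le> card (nonzero_pairs ?Q) \<and> card (nonzero_pairs ?Q) \<le> n" by (rule step.IH)
  then show ?case
    using card_nonzero_pairs_extend[OF Q block_in_new_blocks[OF P(1) B]]
    by (auto simp: extend_restrict[OF P(1) B])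
qed

section \<open>The polynomial identity\<close>

declare of_nat_Suc [simp]

lemma sum_odd_products:
  fixes n r :: nat
  shows "(\<Sum>P\<in>separated_partitions r (n + r).
      \<Prod>i=1..card (nonzero_pairs P) - r. [:- (2 * real i - 1), 1:]) = [:2 * real r, 1:] ^ n"
proof (induction n)
  case 0
  then show ?case by (simp add: separated_partitions_base)
next
  case (Suc n)
  define w where "w k = (\<Prod>i=1..k - r. [:- (2 * real i - 1), 1:])" for k
  have "(\<Sum>P\<in>separated_partitions r (Suc (n + r)). w (card (nonzero_pairs P))) =
     (\<Sum>Q\<in>separated_partitions r (n + r). of_nat (2 * card (nonzero_pairs Q) + 1) * w (card (nonzero_pairs Q))
       + w (Suc (card (nonzero_pairs Q))))"
    by (rule sum_separated_Suc) simp
  also have "\<dots> = (\<Sum>Q\<in>separated_partitions r (n + r). [:2 * real r, 1:] * w (card (nonzero_pairs Q)))"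
  proof (intro sum.cong refl)
    fix Q assume "Q \<in> separated_partitions r (n + r)"
    then have k: "r \<le> card (nonzero_pairs Q)" (is "r \<le> ?k")
      using card_nonzero_pairs_bounds[of r "n + r" Q] by simp
    \<comment> \<open>The weight of one more pair has the additional factor $x - (2(k-r)+1)$, and the $2k+1$ other
      insertions turn this factor into $x + 2r$.\<close>
    have "w (Suc ?k) = [:- (2 * real (Suc (?k - r)) - 1), 1:] * w ?k"
      unfolding w_def Suc_diff_le[OF k] by (rule prod.nat_ivl_Suc') simp
    then have "of_nat (2 * ?k + 1) * w ?k + w (Suc ?k)
        = (of_nat (2 * ?k + 1) + [:- (2 * real (Suc (?k - r)) - 1), 1:]) * w ?k"
      by (simp only: distrib_right)
    also have "of_nat (2 * ?k + 1) + [:- (2 * real (Suc (?k - r)) - 1), 1:] = [:2 * real r, 1:]"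
      using k by (simp add: of_nat_poly of_nat_diff algebra_simps del: of_nat_add of_nat_Suc of_nat_mult) simp
    finally show "of_nat (2 * ?k + 1) * w ?k + w (Suc ?k) = [:2 * real r, 1:] * w ?k" .
  qed
  also have "\<dots> = [:2 * real r, 1:] * [:2 * real r, 1:] ^ n"
    using Suc by (simp only: sum_distrib_left[symmetric] w_def)
  finally show ?case by (simp only: w_def add_Suc power_Suc)
qed

theorem theorem4p6:
  fixes n r :: nat
  shows "[:2 * real r, 1:] ^ n =
    (\<Sum>k=0..n. of_nat (r_Stirling_B (n + r) (k + r) r) *
       (\<Prod>i=1..k. [:- (2 * real i - 1), 1:]))"
proof -
  let ?T = "separated_partitions r (n + r)"
  let ?w = "\<lambda>k. \<Prod>i=1..k. [:- (2 * real i - 1), 1:]"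
  have "[:2 * real r, 1:] ^ n = (\<Sum>P\<in>?T. ?w (card (nonzero_pairs P) - r))"
    by (rule sum_odd_products[symmetric])
  also have "\<dots> = (\<Sum>k\<in>{0..n}. \<Sum>P\<in>{P \<in> ?T. card (nonzero_pairs P) - r = k}.
      ?w (card (nonzero_pairs P) - r))"
    by (rule sum.group[symmetric])
      (use card_nonzero_pairs_bounds[of r "n + r"] finite_separated_partitions in force)+
  also have "\<dots> = (\<Sum>k=0..n. of_nat (r_Stirling_B (n + r) (k + r) r) * ?w k)"
  proof (intro sum.cong refl)
    fix k
    have "{P \<in> ?T. card (nonzero_pairs P) - r = k}
        = {P. typeB_partition (n + r) P \<and> card (nonzero_pairs P) = k + r \<and> r_separated r P}"
      using card_nonzero_pairs_bounds[of r "n + r"] by (force simp: separated_partitions_def)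
    then have "of_nat (r_Stirling_B (n + r) (k + r) r) * ?w k
        = (\<Sum>P\<in>{P \<in> ?T. card (nonzero_pairs P) - r = k}. ?w k)"
      by (simp add: r_Stirling_B_def)
    also have "\<dots> = (\<Sum>P\<in>{P \<in> ?T. card (nonzero_pairs P) - r = k}. ?w (card (nonzero_pairs P) - r))"
      by (intro sum.cong) auto
    finally show "(\<Sum>P\<in>{P \<in> ?T. card (nonzero_pairs P) - r = k}. ?w (card (nonzero_pairs P) - r))
        = of_nat (r_Stirling_B (n + r) (k + r) r) * ?w k" ..
  qed
  finally show ?thesis .
qed

end
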